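(* Let $k$ be a nonnegative integer and let $n$ be a positive integer. Then $$ s(n,k)=(-1)^{n+k}(n-1)!\sum_{\substack{\mu\in\mathcal P^{*}\\ \ell(\mu)=k-1\\ \mu_1<n}}\pi(\mu)^{-1} =(-1)^{n+k}\sum_{\substack{\mu\in\mathcal P^{*}\\ \ell(\mu)=n-k\\ \mu_1<n}}\pi(\mu), $$ where the first sum is over all linear partitions $\mu$ with exactly $k-1$ parts, all of which are distinct and less than $n$, and the second sum is over all linear partitions $\mu$ with exactly $n-k$ parts, all of which are distinct and less than $n$.
   Context: For a positive integer $n$, $(y)_n=y(y-1)\cdots(y-n+1)$, and the Stirling number of the first kind $s(n,k)$ of degree $n$ and order $k\ge0$ is the coefficient of $y^k$ in $(y)_n$. A linear partition is a nonincreasing infinite sequence $\mu=(\mu_i)_{i\ge1}$ of nonnegative integers that is eventually zero. The nonzero $\mu_i$ are the parts of $\mu$, $\ell(\mu)$ is the number of parts, and $\pi(\mu)$ is the product of the parts. $\mathcal P^{*}$ is the set of all linear partitions whose parts are pairwise distinct. The zero sequence is a linear partition (with distinct parts) having no parts, and the product of its parts is $1$. There are no partitions with a negative number of parts, so a sum over such partitions is $0$. *)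

theory Defs
  imports Complex_Main "HOL-Computational_Algebra.Polynomial"
begin

definition falling_factorial :: "'a::comm_ring_1 \<Rightarrow> nat \<Rightarrow> 'a" where
  "falling_factorial y n = (\<Prod>i<n. y - of_nat i)"

text \<open>Signed, unlike the library's \<open>stirling\<close>; the indeterminate \<open>y\<close> is \<open>[:0, 1:]\<close>.\<close>

definition stirling_first :: "nat \<Rightarrow> nat \<Rightarrow> int" where
  "stirling_first n k = coeff (falling_factorial [:0, 1:] n) k"

text \<open>Sequences are indexed from 0: \<open>\<mu> i\<close> is the term written $\mu_{i+1}$ on paper, so
  that \<open>\<mu> 0\<close> is the largest term.\<close>

definition linear_partitions :: "(nat \<Rightarrow> nat) set" where
  "linear_partitions = {\<mu>. antimono \<mu> \<and> (\<forall>\<^sub>F i in sequentially. \<mu> i = 0)}"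

definition part_positions :: "(nat \<Rightarrow> nat) \<Rightarrow> nat set" where
  "part_positions \<mu> = {i. \<mu> i \<noteq> 0}"

definition num_parts :: "(nat \<Rightarrow> nat) \<Rightarrow> nat" where
  "num_parts \<mu> = card (part_positions \<mu>)"

definition prod_parts :: "(nat \<Rightarrow> nat) \<Rightarrow> nat" where
  "prod_parts \<mu> = (\<Prod>i\<in>part_positions \<mu>. \<mu> i)"

definition distinct_partitions :: "(nat \<Rightarrow> nat) set" where
  "distinct_partitions = {\<mu> \<in> linear_partitions. inj_on \<mu> (part_positions \<mu>)}"

text \<open>Finiteness of the partitions summed over, so that sums over any subset of them are
  genuine finite sums.\<close>

lemma finite_part_positions:
  assumes "\<mu> \<in> linear_partitions"
  shows "finite (part_positions \<mu>)"
proof -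
  obtain N where "\<forall>i\<ge>N. \<mu> i = 0"
    using assms by (auto simp: linear_partitions_def eventually_sequentially)
  then have "part_positions \<mu> \<subseteq> {..<N}"
    by (force simp: part_positions_def not_less[symmetric])
  then show ?thesis
    by (rule finite_subset) simp
qed

lemma finite_distinct_partitions_bounded:
  "finite {\<mu> \<in> distinct_partitions. \<mu> 0 < n}"
proof (rule finite_subset)
  let ?F = "{\<mu>. \<forall>i. (i \<in> {..<n} \<longrightarrow> \<mu> i \<in> {..<n}) \<and> (i \<notin> {..<n} \<longrightarrow> \<mu> i = 0)}"
  show "finite ?F"
    by (rule finite_set_of_finite_funs) auto
  show "{\<mu> \<in> distinct_partitions. \<mu> 0 < n} \<subseteq> ?F"
  proof clarify
    fix \<mu> i assume \<mu>: "\<mu> \<in> distinct_partitions" "\<mu> 0 < n"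
    then have anti: "antimono \<mu>" and inj: "inj_on \<mu> (part_positions \<mu>)"
      by (auto simp: distinct_partitions_def linear_partitions_def)
    have le: "\<mu> j < n" for j
      using antimonoD[OF anti, of 0 j] \<mu>(2) by simp
    have "\<mu> i = 0" if "n \<le> i"
    proof (rule ccontr)
      assume "\<mu> i \<noteq> 0"
      then have pos: "\<mu> j \<noteq> 0" if "j \<le> i" for j
        using antimonoD[OF anti that] by simp
      then have "inj_on \<mu> {..i}"
        by (intro inj_on_subset[OF inj]) (auto simp: part_positions_def)
      moreover have "\<mu> ` {..i} \<subseteq> {..<n}"
        using le by auto
      ultimately have "card {..i} \<le> card {..<n}"
        by (rule card_inj_on_le) simp
      with that show False by simp
    qed
    with le show "(i \<in> {..<n} \<longrightarrow> \<mu> i \<in> {..<n}) \<and> (i \<notin> {..<n} \<longrightarrow> \<mu> i = 0)"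
      by simp
  qed
qed

end

theory Submission imports Defs begin

text \<open>A partition into distinct parts is the decreasing enumeration of the set of its parts, so
  the two sums run over the subsets of \<open>{1..<n}\<close> with \<open>k - 1\<close> and \<open>n - k\<close> elements. Expanding
  the falling factorial over the subsets of \<open>{..<n}\<close> identifies the Stirling number with the
  second sum, since a subset containing \<open>0\<close> contributes nothing. Complementation in \<open>{1..<n}\<close>,
  whose product is \<open>(n - 1)!\<close>, carries the second sum to the first.\<close>

definition parts :: "(nat \<Rightarrow> nat) \<Rightarrow> nat set" where
  "parts \<mu> = \<mu> ` part_positions \<mu>"

text \<open>On finite sets of positive integers this is the inverse of \<open>parts\<close>; the
  reversal gives the order that a partition requires, and the padding with zeros makes the sequence
  eventually zero.\<close>

definition decreasing_enum :: "nat set \<Rightarrow> nat \<Rightarrow> nat" where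
  "decreasing_enum A i = (if i < card A then rev (sorted_list_of_set A) ! i else 0)"

text \<open>Monotonicity makes the set of positions downward closed, and a finite downward closed
  set of naturals is an initial segment.\<close>

lemma part_positions_eq_lessThan:
  assumes "\<mu> \<in> linear_partitions"
  shows "part_positions \<mu> = {..<num_parts \<mu>}"
proof -
  have anti: "antimono \<mu>"
    using assms by (simp add: linear_partitions_def)
  have down: "j \<in> part_positions \<mu>" if "i \<in> part_positions \<mu>" "j \<le> i" for i j
    using that antimonoD[OF anti that(2)] by (simp add: part_positions_def)
  have fin: "finite (part_positions \<mu>)"
    using assms by (rule finite_part_positions)
  show ?thesis
  proof (cases "part_positions \<mu> = {}")
    case True
    then show ?thesis by (simp add: num_parts_def)
  next
    case False
    then have "part_positions \<mu> = {..Max (part_positions \<mu>)}"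
      using fin by (auto intro: down[OF Max_in])
    then have "part_positions \<mu> = {..<Suc (Max (part_positions \<mu>))}"
      by (simp add: lessThan_Suc_atMost)
    then show ?thesis
      by (metis num_parts_def card_lessThan)
  qed
qed

lemma
  assumes "\<mu> \<in> distinct_partitions"
  shows card_parts: "card (parts \<mu>) = num_parts \<mu>"
    and prod_id_parts: "\<Prod>(parts \<mu>) = prod_parts \<mu>"
  using assms
  by (auto simp: parts_def num_parts_def prod_parts_def distinct_partitions_def
      card_image prod.reindex)

lemma decreasing_enum_parts:
  assumes "\<mu> \<in> distinct_partitions"
  shows "decreasing_enum (parts \<mu>) = \<mu>"
proof -
  have lin: "\<mu> \<in> linear_partitions" and inj: "inj_on \<mu> (part_positions \<mu>)"
    using assms by (auto simp: distinct_partitions_def)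
  then have anti: "antimono \<mu>"
    by (simp add: linear_partitions_def)
  define m where "m = num_parts \<mu>"
  have pos: "part_positions \<mu> = {..<m}"
    unfolding m_def using lin by (rule part_positions_eq_lessThan)
  have card: "card (parts \<mu>) = m"
    using assms by (simp add: card_parts m_def)
  \<comment> \<open>A finite set has only one sorted listing without repetition, so it suffices that
    the reversed list of the first \<open>m\<close> values is one for
    \<open>parts \<mu>\<close>.\<close>
  let ?l = "rev (map \<mu> [0..<m])"
  have "sorted ?l"
    using antimonoD[OF anti] by (auto simp: sorted_iff_nth_mono rev_nth)
  moreover have "distinct ?l"
    using inj by (simp add: distinct_map pos atLeast0LessThan)
  moreover have "set ?l = parts \<mu>"
    by (simp add: parts_def pos atLeast0LessThan)
  ultimately have "sorted_list_of_set (parts \<mu>) = ?l"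
    by (metis sorted_list_of_set.idem_if_sorted_distinct)
  then have "decreasing_enum (parts \<mu>) i = \<mu> i" if "i < m" for i
    using that by (simp add: decreasing_enum_def card)
  moreover have "decreasing_enum (parts \<mu>) i = \<mu> i" if "\<not> i < m" for i
  proof -
    have "i \<notin> part_positions \<mu>"
      using that by (simp add: pos)
    then show ?thesis
      using that by (simp add: decreasing_enum_def card part_positions_def)
  qed
  ultimately show ?thesis
    by (intro ext) metis
qed

text \<open>As \<open>0\<close> is not in \<open>A\<close>, every listed entry is nonzero, so the
  positions outside \<open>part_positions\<close> are exactly the padded ones. Finiteness matters
  because \<open>sorted_list_of_set\<close> returns the empty list on infinite sets.\<close>

lemma
  assumes fin: "finite A" and zero: "0 \<notin> A"
  shows parts_decreasing_enum: "parts (decreasing_enum A) = A"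
    and decreasing_enum_in: "decreasing_enum A \<in> distinct_partitions"
proof -
  let ?l = "rev (sorted_list_of_set A)"
  have nz: "?l ! i \<noteq> 0" if "i < card A" for i
    using that fin zero nth_mem[of i ?l] by (metis length_rev length_sorted_list_of_set
        set_rev set_sorted_list_of_set)
  have pos: "part_positions (decreasing_enum A) = {..<card A}"
    using nz by (auto simp: part_positions_def decreasing_enum_def)
  show "parts (decreasing_enum A) = A"
  proof -
    have "parts (decreasing_enum A) = (\<lambda>i. ?l ! i) ` {..<length ?l}"
      unfolding parts_def pos by (simp add: decreasing_enum_def)
    also have "\<dots> = set ?l"
      by (auto simp: set_conv_nth)
    finally show ?thesis
      using fin by simp
  qed
  have "inj_on (decreasing_enum A) {..<card A}"
    using fin by (auto simp: inj_on_def decreasing_enum_def nth_eq_iff_index_eq)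
  moreover have "?l ! j \<le> ?l ! i" if "i \<le> j" "j < card A" for i j
    using that sorted_rev_nth_mono[of ?l i j] by simp
  then have "antimono (decreasing_enum A)"
    by (auto simp: antimono_def decreasing_enum_def)
  moreover have "\<forall>\<^sub>F i in sequentially. decreasing_enum A i = 0"
    unfolding eventually_sequentially by (rule exI[of _ "card A"]) (simp add: decreasing_enum_def)
  ultimately show "decreasing_enum A \<in> distinct_partitions"
    by (simp add: distinct_partitions_def linear_partitions_def pos)
qed

lemma largest_part_less_iff:
  assumes "\<mu> \<in> linear_partitions" "n > 0"
  shows "\<mu> 0 < n \<longleftrightarrow> parts \<mu> \<subseteq> {1..<n}"
proof
  assume "\<mu> 0 < n"
  then have "\<mu> i < n" for i
    using assms(1) antimonoD[of \<mu> 0 i] by (simp add: linear_partitions_def)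
  then show "parts \<mu> \<subseteq> {1..<n}"
    by (auto simp: parts_def part_positions_def)
next
  assume "parts \<mu> \<subseteq> {1..<n}"
  then show "\<mu> 0 < n"
    \<comment> \<open>If \<open>\<mu> 0 = 0\<close> there are no parts and the inclusion says
      nothing about \<open>\<mu> 0\<close>; the bound then comes from \<open>n > 0\<close>.\<close>
    using assms(2) by (cases "\<mu> 0 = 0") (auto simp: parts_def part_positions_def)
qed

text \<open>The maps \<open>parts\<close> and \<open>decreasing_enum\<close> are mutually inverse
  between the two index sets. The number of parts is compared as an integer so that
  \<open>k - 1\<close> for \<open>k = 0\<close> and \<open>n - k\<close> for \<open>k > n\<close>
  are negative and give empty sums.\<close>

lemma sum_distinct_partitions:
  fixes g :: "nat \<Rightarrow> 'a::comm_monoid_add" and m :: int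
  assumes "n > 0"
  shows "(\<Sum>\<mu> | \<mu> \<in> distinct_partitions \<and> int (num_parts \<mu>) = m \<and> \<mu> 0 < n. g (prod_parts \<mu>)) =
         (\<Sum>A | A \<subseteq> {1..<n} \<and> int (card A) = m. g (\<Prod>A))"
proof (rule sum.reindex_bij_witness[where i = decreasing_enum and j = parts])
  fix \<mu> assume "\<mu> \<in> {\<mu> \<in> distinct_partitions. int (num_parts \<mu>) = m \<and> \<mu> 0 < n}"
  then have \<mu>: "\<mu> \<in> distinct_partitions" "int (num_parts \<mu>) = m" "\<mu> 0 < n"
    by auto
  then have "\<mu> \<in> linear_partitions"
    by (simp add: distinct_partitions_def)
  with \<mu> assms show "parts \<mu> \<in> {A. A \<subseteq> {1..<n} \<and> int (card A) = m}"
    by (simp add: largest_part_less_iff card_parts)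
  show "decreasing_enum (parts \<mu>) = \<mu>" "g (\<Prod>(parts \<mu>)) = g (prod_parts \<mu>)"
    using \<mu> by (simp_all add: decreasing_enum_parts prod_id_parts)
next
  fix A assume "A \<in> {A. A \<subseteq> {1..<n} \<and> int (card A) = m}"
  then have A: "A \<subseteq> {1..<n}" "int (card A) = m"
    by auto
  then have fin: "finite A" and "0 \<notin> A"
    by (auto intro: finite_subset)
  then have enum: "parts (decreasing_enum A) = A" "decreasing_enum A \<in> distinct_partitions"
    by (rule parts_decreasing_enum decreasing_enum_in)+
  then have "decreasing_enum A \<in> linear_partitions"
    by (simp add: distinct_partitions_def)
  with A enum assms card_parts[OF enum(2)]
  show "decreasing_enum A \<in> {\<mu> \<in> distinct_partitions. int (num_parts \<mu>) = m \<and> \<mu> 0 < n}"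
    by (simp add: largest_part_less_iff)
  show "parts (decreasing_enum A) = A"
    by (rule enum)
qed

text \<open>A term of the expanded product takes the constant \<open>- i\<close> from the factors
  with index in \<open>A\<close> and the indeterminate from the others, so it contributes to degree
  \<open>n - card A\<close> only.\<close>

lemma stirling_first_eq_sum_subsets:
  "stirling_first n k =
     (-1) ^ (n + k) * (\<Sum>A | A \<subseteq> {1..<n} \<and> int (card A) = int n - int k. int (\<Prod>A))"
proof -
  let ?c = "\<lambda>A. if n - card A = k then \<Prod>i\<in>A. - int i else 0"
  have "falling_factorial [:0, 1::int:] n = (\<Prod>i<n. [:- int i:] + [:0, 1:])"
    unfolding falling_factorial_def by (rule prod.cong) (auto simp: of_nat_poly)
  also have "\<dots> = (\<Sum>A\<in>Pow {..<n}. (\<Prod>i\<in>A. [:- int i:]) * (\<Prod>i\<in>{..<n} - A. [:0, 1:]))"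
    by (rule prod_add) simp
  also have "\<dots> = (\<Sum>A\<in>Pow {..<n}. monom (\<Prod>i\<in>A. - int i) (n - card A))"
  proof (rule sum.cong)
    fix A assume "A \<in> Pow {..<n}"
    then have "card ({..<n} - A) = n - card A"
      by (simp add: card_Diff_subset finite_subset)
    moreover have "(\<Prod>i\<in>A. [:- int i:]) = [:\<Prod>i\<in>A. - int i:]"
      by (induction A rule: infinite_finite_induct) (auto simp: one_pCons)
    ultimately show "(\<Prod>i\<in>A. [:- int i:]) * (\<Prod>i\<in>{..<n} - A. [:0, 1:]) =
        monom (\<Prod>i\<in>A. - int i) (n - card A)"
      by (simp add: monom_altdef)
  qed simp
  finally have "stirling_first n k = (\<Sum>A\<in>Pow {..<n}. ?c A)"
    by (simp add: stirling_first_def coeff_sum)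
  \<comment> \<open>A discarded set either contains \<open>0\<close>, so that its product vanishes,
    or has the wrong degree. Since \<open>card A \<le> n\<close>, the truncated subtraction in
    \<open>?c\<close> agrees with the integer one.\<close>
  also have "\<dots> = (\<Sum>A | A \<subseteq> {1..<n} \<and> int (card A) = int n - int k. ?c A)"
  proof (rule sum.mono_neutral_right)
    show "\<forall>A \<in> Pow {..<n} - {A. A \<subseteq> {1..<n} \<and> int (card A) = int n - int k}. ?c A = 0"
    proof
      fix A assume A: "A \<in> Pow {..<n} - {A. A \<subseteq> {1..<n} \<and> int (card A) = int n - int k}"
      then have fin: "finite A" and "card A \<le> n"
        using card_mono[of "{..<n}" A] by (auto intro: finite_subset)
      show "?c A = 0"
      proof (cases "0 \<in> A")
        case True
        then show ?thesis using fin by auto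
      next
        case False
        then have "A \<subseteq> {1..<n}"
          using A by (auto simp: Suc_le_eq intro: gr0I)
        then show ?thesis
          using A \<open>card A \<le> n\<close> by auto
      qed
    qed
  qed auto
  also have "\<dots> = (\<Sum>A | A \<subseteq> {1..<n} \<and> int (card A) = int n - int k. (-1) ^ (n + k) * int (\<Prod>A))"
  proof (rule sum.cong)
    fix A assume "A \<in> {A. A \<subseteq> {1..<n} \<and> int (card A) = int n - int k}"
    then have n: "n = card A + k"
      by auto
    \<comment> \<open>The exponents differ by \<open>2 * k\<close>, as
      \<open>n + k = card A + 2 * k\<close>.\<close>
    then have "(-1::int) ^ card A = (-1) ^ (n + k)"
      by (simp add: power_add flip: power_mult_distrib)
    with n show "?c A = (-1) ^ (n + k) * int (\<Prod>A)"
      by (simp add: prod_uminus)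
  qed simp
  finally show ?thesis
    by (simp add: sum_distrib_left)
qed

text \<open>Dividing \<open>(n - 1)!\<close> by the product over \<open>A\<close> leaves the product
  over the complement of \<open>A\<close> in \<open>{1..<n}\<close>, and a set of size
  \<open>k - 1\<close> has a complement of size \<open>n - k\<close>.\<close>

lemma sum_subsets_complement:
  fixes n k :: nat
  assumes "n > 0"
  shows "fact (n - 1) *
           (\<Sum>A | A \<subseteq> {1..<n} \<and> int (card A) = int k - 1. inverse (rat_of_nat (\<Prod>A))) =
         (\<Sum>A | A \<subseteq> {1..<n} \<and> int (card A) = int n - int k. rat_of_nat (\<Prod>A))"
  unfolding sum_distrib_left
proof (rule sum.reindex_bij_witness[where i = "\<lambda>A. {1..<n} - A" and j = "\<lambda>A. {1..<n} - A"])
  \<comment> \<open>Here \<open>n > 0\<close> ensures that \<open>{1..<n}\<close> has the integer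
    \<open>n - 1\<close> as its cardinality.\<close>
  have card: "int (card ({1..<n} - A)) = int n - 1 - int (card A)" if "A \<subseteq> {1..<n}" for A
    using that assms card_mono[of "{1..<n}" A] by (simp add: card_Diff_subset finite_subset)
  fix A
  { assume "A \<in> {A. A \<subseteq> {1..<n} \<and> int (card A) = int k - 1}"
    then show "{1..<n} - A \<in> {A. A \<subseteq> {1..<n} \<and> int (card A) = int n - int k}"
      using card[of A] by auto }
  { assume "A \<in> {A. A \<subseteq> {1..<n} \<and> int (card A) = int n - int k}"
    then show "{1..<n} - A \<in> {A. A \<subseteq> {1..<n} \<and> int (card A) = int k - 1}"
      using card[of A] by auto }
  assume "A \<in> {A. A \<subseteq> {1..<n} \<and> int (card A) = int k - 1}"
  then have A: "A \<subseteq> {1..<n}" by simp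
  then have "finite A" "0 \<notin> A"
    by (auto intro: finite_subset)
  then have nz: "rat_of_nat (\<Prod>A) \<noteq> 0"
    by simp
  have "{1..n - 1} = {1..<n}"
    using assms by auto
  then have "fact (n - 1) = rat_of_nat (\<Prod>{1..<n})"
    by (simp add: fact_prod)
  moreover have "\<Prod>{1..<n} = \<Prod>({1..<n} - A) * \<Prod>A"
    using A by (rule prod.subset_diff) simp
  ultimately have "fact (n - 1) = rat_of_nat (\<Prod>({1..<n} - A)) * rat_of_nat (\<Prod>A)"
    by (simp only: of_nat_mult)
  with nz show "rat_of_nat (\<Prod>({1..<n} - A)) = fact (n - 1) * inverse (rat_of_nat (\<Prod>A))"
    by (simp only: mult.assoc right_inverse mult_1_right not_False_eq_True)
qed auto

theorem proposition2p7:
  fixes n k :: nat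
  assumes "n > 0"
  shows "rat_of_int (stirling_first n k) =
           (- 1) ^ (n + k) * fact (n - 1) *
             (\<Sum>\<mu> | \<mu> \<in> distinct_partitions \<and> int (num_parts \<mu>) = int k - 1 \<and> \<mu> 0 < n.
                inverse (rat_of_nat (prod_parts \<mu>)))
       \<and> (- 1) ^ (n + k) * fact (n - 1) *
             (\<Sum>\<mu> | \<mu> \<in> distinct_partitions \<and> int (num_parts \<mu>) = int k - 1 \<and> \<mu> 0 < n.
                inverse (rat_of_nat (prod_parts \<mu>))) =
           (- 1) ^ (n + k) *
             (\<Sum>\<mu> | \<mu> \<in> distinct_partitions \<and> int (num_parts \<mu>) = int n - int k \<and> \<mu> 0 < n.
                rat_of_nat (prod_parts \<mu>))"
proof -
  note sums = sum_distinct_partitions[OF assms, of "\<lambda>x. inverse (rat_of_nat x)"]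
    sum_distinct_partitions[OF assms, of rat_of_nat]
  have "rat_of_int (stirling_first n k) = (- 1) ^ (n + k) *
      (\<Sum>A | A \<subseteq> {1..<n} \<and> int (card A) = int n - int k. rat_of_nat (\<Prod>A))"
    unfolding stirling_first_eq_sum_subsets of_int_mult of_int_sum of_int_power of_int_minus
      of_int_1 of_int_of_nat_eq ..
  \<comment> \<open>Once both sums run over subsets, \<open>mult.assoc\<close> puts the factorial
    next to the sum of reciprocals. Complementation then turns the first conjunct into the formula
    just obtained and the second into an identity of equal terms.\<close>
  then show ?thesis
    unfolding sums mult.assoc sum_subsets_complement[OF assms] by (rule conjI) (rule refl)
qed

end
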